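(* Let $G$ be a weighted directed or undirected graph on the node set $\{1,\dots,n\}$ with adjacency matrix $A_G\in\mathbb{R}^{n\times n}$, and let $S_{ij}^{\mathrm{TN}}(A_G)$ denote the total network sensitivity of $G$ with respect to changes in $w_{ij}$. Then, for all $i,j\in\{1,\dots,n\}$, $$S_{ij}^{\mathrm{TN}}(A_G) = [L_{\exp}(A_G^T,\mathbf{1}\mathbf{1}^T)]_{ij}.$$
   Context: A weighted (di)graph $G=(\mathcal V,\mathcal E,w)$ has nodes $\mathcal V=\{1,\dots,n\}$, edges $\mathcal E\subseteq \mathcal V\times\mathcal V$ (no self loops, no multiple edges) and weights $w_{ij}>0$ for $(i,j)\in\mathcal E$. Its adjacency matrix $A_G$ has entries $a_{ij}=w_{ij}$ if $(i,j)\in\mathcal E$ and $a_{ij}=0$ otherwise. $\mathbf{1}\in\mathbb{R}^n$ is the vector of all ones, $\mathbf e_i$ the $i$th canonical unit vector, and $E_{ij}=\mathbf e_i\mathbf e_j^T$. $L_{\exp}(A,\cdot)$ is the Fréchet derivative of the matrix exponential at $A$, i.e., the linear operator with $\exp(A+E)-\exp(A)=L_{\exp}(A,E)+o(\|E\|)$. The total network sensitivity with respect to changes in $w_{ij}$ is defined as $S^{\mathrm{TN}}_{ij}(A_G) := \mathbf{1}^T L_{\exp}(A_G,E_{ij})\mathbf{1}$. *)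

theory Defs
  imports "HOL-Analysis.Analysis"
begin

text \<open>
  The nodes are the elements of a finite type \<open>'n\<close>, where \<open>n = CARD('n)\<close>. Edges form a set of
  ordered pairs, so multiple edges cannot occur. An undirected graph is a digraph with a symmetric
  edge relation and symmetric weights, hence a special case.
\<close>

definition weighted_digraph :: "('n \<times> 'n) set \<Rightarrow> ('n \<Rightarrow> 'n \<Rightarrow> real) \<Rightarrow> bool" where
  "weighted_digraph E w \<longleftrightarrow> irrefl E \<and> (\<forall>(i, j) \<in> E. w i j > 0)"

definition adjacency_matrix :: "('n \<times> 'n) set \<Rightarrow> ('n::finite \<Rightarrow> 'n \<Rightarrow> real) \<Rightarrow> real^'n^'n" where
  "adjacency_matrix E w = (\<chi> i j. if (i, j) \<in> E then w i j else 0)"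

text \<open>
  The operations \<open>*\<close> and \<open>^\<close> on \<open>real^'n^'n\<close> act entrywise, and \<open>exp\<close> is not available on this type.
  The exponential is therefore given by its power series in terms of the matrix product \<open>**\<close>.
\<close>

definition matrix_pow :: "real^'n^'n \<Rightarrow> nat \<Rightarrow> real^'n^'n" where
  "matrix_pow A k = (((**) A) ^^ k) (mat 1)"

definition matrix_exp :: "real^'n^'n \<Rightarrow> real^'n^'n" where
  "matrix_exp A = (\<Sum>k. (1 / fact k) *\<^sub>R matrix_pow A k)"

definition L_exp :: "real^'n^'n \<Rightarrow> real^'n^'n \<Rightarrow> real^'n^'n" where
  "L_exp A = frechet_derivative matrix_exp (at A)"

definition outer_product :: "real^'n \<Rightarrow> real^'n \<Rightarrow> real^'n^'n" where
  "outer_product u v = (\<chi> i j. u $ i * v $ j)"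

text \<open>
  The unit \<open>1\<close> of the type \<open>real^'n\<close> is the vector of all ones, and \<open>axis i 1\<close> is the \<open>i\<close>-th
  canonical unit vector.
\<close>

definition total_network_sensitivity :: "real^'n^'n \<Rightarrow> 'n \<Rightarrow> 'n \<Rightarrow> real" where
  "total_network_sensitivity A i j =
     (1 :: real^'n) \<bullet> (L_exp A (outer_product (axis i 1) (axis j 1)) *v 1)"

end

theory Submission
  imports Defs
begin

text \<open>
  Termwise differentiation of the exponential series gives
  \<open>L_exp A H = (\<Sum>k. (1 / fact k) *\<^sub>R (\<Sum>p<k. A\<^sup>p H A\<^bsup>k-1-p\<^esup>))\<close>. For \<open>H = u v\<^sup>T\<close> each summand
  satisfies \<open>x\<^sup>T (P u v\<^sup>T Q) y = u\<^sup>T (P\<^sup>T x y\<^sup>T Q\<^sup>T) v\<close>, and the claim is the case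
  \<open>x = y = \<one>\<close>, \<open>u = e\<^sub>i\<close>, \<open>v = e\<^sub>j\<close>.
\<close>

section \<open>Matrix powers, transposition and norm bounds\<close>

lemma matrix_pow_0 [simp]: "matrix_pow A 0 = mat 1"
  and matrix_pow_Suc: "matrix_pow A (Suc k) = A ** matrix_pow A k"
  by (simp_all add: matrix_pow_def)

lemma matrix_pow_Suc2: "matrix_pow A (Suc k) = matrix_pow A k ** A"
  by (induction k) (simp_all add: matrix_pow_Suc matrix_mul_assoc)

lemma transpose_matrix_pow: "transpose (matrix_pow A k) = matrix_pow (transpose A) k"
proof (induction k)
  case (Suc k)
  then show ?case
    by (subst matrix_pow_Suc2) (simp add: matrix_pow_Suc matrix_transpose_mul)
qed simp

text \<open>Bilinearity suffices, since the spaces are finite-dimensional. Boundedness yields both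
  the product rule and submultiplicativity of the norm up to a constant.\<close>

lemma bounded_bilinear_matrix_matrix_mult:
  "bounded_bilinear ((**) :: real^'n^'m \<Rightarrow> real^'p^'n \<Rightarrow> real^'p^'m)"
  unfolding bilinear_conv_bounded_bilinear[symmetric] bilinear_def
  by (intro conjI allI linearI)
    (simp_all add: vec_eq_iff matrix_matrix_mult_def sum.distrib sum_distrib_left
      distrib_left distrib_right mult_ac)

lemma bounded_linear_bilinear_form:
  "bounded_linear (\<lambda>A :: real^'n^'m. x \<bullet> (A *v y))"
  unfolding linear_conv_bounded_linear[symmetric]
  by (rule linearI)
    (simp_all add: matrix_vector_mult_add_rdistrib inner_add_right
      flip: scaleR_matrix_vector_assoc)

text \<open>\<open>C\<close> and \<open>M\<close> depend on \<open>r\<close> but not on the matrix: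
  termwise differentiation needs bounds that are uniform on a ball.\<close>

lemma norm_matrix_pow_le:
  fixes r :: real
  obtains C M where "C \<ge> 0" "M \<ge> 1"
    "\<And>(A :: real^'n^'n) k. norm A \<le> r \<Longrightarrow> norm (matrix_pow A k) \<le> C * M ^ k"
proof -
  obtain K where K: "K > 0"
      "\<And>(A :: real^'n^'n) (B :: real^'n^'n). norm (A ** B) \<le> norm A * norm B * K"
    using bounded_bilinear.pos_bounded[OF bounded_bilinear_matrix_matrix_mult] by blast
  \<comment> \<open>\<open>r * K\<close> bounds the growth caused by one more factor; the maximum
    with 1 makes \<open>M ^ k\<close> increasing in \<open>k\<close>.\<close>
  define M where "M = max 1 (r * K)"
  have "norm (matrix_pow A k) \<le> norm (mat 1 :: real^'n^'n) * M ^ k"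
    if A: "norm A \<le> r" for A :: "real^'n^'n" and k
  proof (induction k)
    case (Suc k)
    have "norm A * K \<le> M"
      using K(1) mult_right_mono[OF A, of K] by (simp add: M_def le_max_iff_disj)
    have "norm (matrix_pow A (Suc k)) \<le> (norm A * K) * norm (matrix_pow A k)"
      using K(2)[of A "matrix_pow A k"] by (simp add: matrix_pow_Suc mult_ac)
    also have "\<dots> \<le> M * (norm (mat 1 :: real^'n^'n) * M ^ k)"
      using \<open>norm A * K \<le> M\<close> Suc by (intro mult_mono) (auto simp: M_def)
    finally show ?case by (simp add: mult_ac)
  qed simp
  then show ?thesis
    using that[of "norm (mat 1 :: real^'n^'n)" M] by (simp add: M_def)
qed

section \<open>Derivatives of matrix powers\<close>

definition matrix_pow_deriv :: "nat \<Rightarrow> real^'n^'n \<Rightarrow> real^'n^'n \<Rightarrow> real^'n^'n" where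
  "matrix_pow_deriv k A H = (\<Sum>p<k. matrix_pow A p ** H ** matrix_pow A (k - 1 - p))"

text \<open>The summand for \<open>p = 0\<close> is the last term; all others share a left factor
  \<open>A\<close>. This is the shape that the product rule gives for
  \<open>A ** matrix_pow A k\<close>.\<close>

lemma matrix_pow_deriv_Suc:
  "matrix_pow_deriv (Suc k) A H = A ** matrix_pow_deriv k A H + H ** matrix_pow A k"
proof -
  have "A ** (\<Sum>p<k. matrix_pow A p ** H ** matrix_pow A (k - 1 - p)) =
      (\<Sum>p<k. A ** (matrix_pow A p ** H ** matrix_pow A (k - 1 - p)))"
    by (rule linear_sum[OF bounded_linear.linear[OF bounded_bilinear.bounded_linear_right
            [OF bounded_bilinear_matrix_matrix_mult]]])
  then show ?thesis
    unfolding matrix_pow_deriv_def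
    by (subst sum.lessThan_Suc_shift) (simp add: matrix_pow_Suc matrix_mul_assoc)
qed

lemma has_derivative_matrix_pow:
  "((\<lambda>A. matrix_pow A k) has_derivative matrix_pow_deriv k A) (at A within S)"
proof (induction k)
  case 0
  have "matrix_pow_deriv 0 A = (\<lambda>H. 0)"
    by (simp add: matrix_pow_deriv_def fun_eq_iff)
  then show ?case by simp
next
  case (Suc k)
  have "((\<lambda>A. A ** matrix_pow A k) has_derivative
      (\<lambda>H. A ** matrix_pow_deriv k A H + H ** matrix_pow A k)) (at A within S)"
    by (rule bounded_bilinear.FDERIV[OF bounded_bilinear_matrix_matrix_mult
          has_derivative_ident Suc])
  then show ?case
    by (simp add: matrix_pow_Suc matrix_pow_deriv_Suc[abs_def])
qed

lemma norm_matrix_pow_deriv_le: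
  fixes r :: real
  obtains C M where "C \<ge> 0" "M \<ge> 1"
    "\<And>(A :: real^'n^'n) H k. norm A \<le> r \<Longrightarrow>
       norm (matrix_pow_deriv k A H) \<le> C * M ^ k * norm H"
proof -
  obtain K where K: "K > 0"
      "\<And>(A :: real^'n^'n) (B :: real^'n^'n). norm (A ** B) \<le> norm A * norm B * K"
    using bounded_bilinear.pos_bounded[OF bounded_bilinear_matrix_matrix_mult] by blast
  obtain C M where C: "C \<ge> 0" and M: "M \<ge> 1"
    and CM: "\<And>(A :: real^'n^'n) k. norm A \<le> r \<Longrightarrow> norm (matrix_pow A k) \<le> C * M ^ k"
    using norm_matrix_pow_le by blast
  \<comment> \<open>Each summand has two powers (\<open>C\<^sup>2\<close>) and two products
    (\<open>K\<^sup>2\<close>); the number \<open>k\<close> of summands is absorbed into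
    \<open>2 ^ k\<close>.\<close>
  have "norm (matrix_pow_deriv k A H) \<le> C\<^sup>2 * K\<^sup>2 * (2 * M) ^ k * norm H"
    if A: "norm A \<le> r" for A H :: "real^'n^'n" and k
  proof -
    have "norm (matrix_pow A p ** H ** matrix_pow A (k - 1 - p)) \<le> C\<^sup>2 * K\<^sup>2 * M ^ k * norm H"
      if p: "p < k" for p
    proof -
      have "norm (matrix_pow A p ** H ** matrix_pow A (k - 1 - p))
          \<le> norm (matrix_pow A p ** H) * norm (matrix_pow A (k - 1 - p)) * K"
        by (rule K(2))
      also have "\<dots> \<le> (C * M ^ p * norm H * K) * (C * M ^ (k - 1 - p)) * K"
        using K C M CM[OF A]
        by (intro mult_mono order_trans[OF K(2)]) auto
      also have "\<dots> = C\<^sup>2 * K\<^sup>2 * norm H * M ^ (p + (k - 1 - p))"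
        by (simp add: power_add power2_eq_square mult_ac)
      also have "\<dots> \<le> C\<^sup>2 * K\<^sup>2 * norm H * M ^ k"
        using p M by (intro mult_left_mono power_increasing) auto
      finally show ?thesis by (simp add: mult_ac)
    qed
    then have "norm (matrix_pow_deriv k A H) \<le> (\<Sum>p<k. C\<^sup>2 * K\<^sup>2 * M ^ k * norm H)"
      unfolding matrix_pow_deriv_def by (intro sum_norm_le) simp
    also have "\<dots> = real k * (C\<^sup>2 * K\<^sup>2 * M ^ k * norm H)"
      by simp
    also have "\<dots> \<le> 2 ^ k * (C\<^sup>2 * K\<^sup>2 * M ^ k * norm H)"
      using M by (intro mult_right_mono of_nat_less_two_power[THEN less_imp_le]) auto
    finally show ?thesis by (simp add: power_mult_distrib mult_ac)
  qed
  then show ?thesis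
    using that[of "C\<^sup>2 * K\<^sup>2" "2 * M"] M by simp
qed

section \<open>The exponential series and its Frechet derivative\<close>

lemma summable_power_over_fact: "summable (\<lambda>k. (1 / fact k) * (C * M ^ k :: real))"
  using summable_mult[OF summable_exp[of M], of C] by (simp add: field_simps)

lemma matrix_exp_sums: "(\<lambda>k. (1 / fact k) *\<^sub>R matrix_pow A k) sums matrix_exp A"
proof -
  obtain C M where "\<And>k. norm (matrix_pow A k) \<le> C * M ^ k"
    using norm_matrix_pow_le[of "norm A"] by (metis order_refl)
  then have "summable (\<lambda>k. (1 / fact k) *\<^sub>R matrix_pow A k)"
    by (intro summable_comparison_test'[OF summable_power_over_fact[of C M]])
      (simp add: divide_right_mono)
  then show ?thesis
    by (simp add: matrix_exp_def summable_sums)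
qed

lemma summable_matrix_pow_deriv: "summable (\<lambda>k. (1 / fact k) *\<^sub>R matrix_pow_deriv k A H)"
proof -
  obtain C M where "\<And>k. norm (matrix_pow_deriv k A H) \<le> C * M ^ k * norm H"
    using norm_matrix_pow_deriv_le[of "norm A"] by (metis order_refl)
  then show ?thesis
    by (intro summable_comparison_test'[OF summable_power_over_fact[of "C * norm H" M]])
      (simp add: divide_right_mono mult_ac)
qed

text \<open>The bound involves only the majorant \<open>b\<close>, so it gives uniform convergence
  for a whole family of series, as in the Weierstrass M-test.\<close>

lemma norm_sum_minus_suminf_le:
  fixes f :: "nat \<Rightarrow> 'a::banach"
  assumes b: "summable b" and f: "\<And>k. norm (f k) \<le> b k"
  shows "norm ((\<Sum>k<n. f k) - suminf f) \<le> (\<Sum>k. b (k + n))"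
proof -
  have "summable f"
    using b f by (rule summable_comparison_test'[where N = 0])
  then have "(\<Sum>k<n. f k) - suminf f = - (\<Sum>k. f (k + n))"
    by (simp add: suminf_split_initial_segment[of f n])
  moreover have "norm (\<Sum>k. f (k + n)) \<le> (\<Sum>k. b (k + n))"
    using f b by (intro norm_suminf_le summable_ignore_initial_segment)
  ultimately show ?thesis by simp
qed

lemma has_derivative_matrix_exp:
  fixes A :: "real^'n^'n"
  shows "(matrix_exp has_derivative
    (\<lambda>H. \<Sum>k. (1 / fact k) *\<^sub>R matrix_pow_deriv k A H)) (at A)"
proof -
  \<comment> \<open>Centred at 0 so that the norm is bounded on \<open>S\<close>; the extra 1 puts
    \<open>A\<close> in the interior.\<close>
  define S :: "(real^'n^'n) set" where "S = ball 0 (norm A + 1)"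
  define f' where "f' = (\<lambda>k (B :: real^'n^'n) H. (1 / fact k) *\<^sub>R matrix_pow_deriv k B H)"
  have AS: "A \<in> S" and "open S" by (auto simp: S_def)
  obtain C M where CM: "\<And>(B :: real^'n^'n) H k. norm B \<le> norm A + 1 \<Longrightarrow>
      norm (matrix_pow_deriv k B H) \<le> C * M ^ k * norm H"
    using norm_matrix_pow_deriv_le by metis
  define b where "b = (\<lambda>k. (1 / fact k) * (C * M ^ k))"
  have b: "summable b"
    unfolding b_def by (rule summable_power_over_fact)
  have f': "norm (f' k B H) \<le> b k * norm H" if "B \<in> S" for k B H
    using CM[of B k H] that by (simp add: f'_def b_def S_def divide_right_mono)
  have "\<exists>g. \<forall>B\<in>S. (\<lambda>k. (1 / fact k) *\<^sub>R matrix_pow B k) sums g B \<and>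
      (g has_derivative (\<lambda>H. \<Sum>k. f' k B H)) (at B within S)"
  proof (rule has_derivative_series[OF _ _ _ AS matrix_exp_sums])
    show "convex S" by (simp add: S_def)
    show "((\<lambda>B. (1 / fact k) *\<^sub>R matrix_pow B k) has_derivative f' k B) (at B within S)" for k B
      unfolding f'_def by (intro has_derivative_scaleR_right has_derivative_matrix_pow)
    show "\<forall>\<^sub>F n in sequentially. \<forall>B\<in>S. \<forall>H.
        norm ((\<Sum>k<n. f' k B H) - (\<Sum>k. f' k B H)) \<le> e * norm H" if e: "e > 0" for e
    proof -
      \<comment> \<open>\<open>N\<close> comes from the tails of \<open>b\<close> alone, hence
        serves all \<open>B\<close> and \<open>H\<close> at once.\<close>
      obtain N where N: "\<And>n. n \<ge> N \<Longrightarrow> norm (\<Sum>k. b (k + n)) < e"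
        using suminf_exist_split[OF e b] by blast
      have "norm ((\<Sum>k<n. f' k B H) - (\<Sum>k. f' k B H)) \<le> e * norm H"
        if "n \<ge> N" "B \<in> S" for n B H
      proof -
        have "norm ((\<Sum>k<n. f' k B H) - (\<Sum>k. f' k B H)) \<le> (\<Sum>k. b (k + n) * norm H)"
          using f'[OF \<open>B \<in> S\<close>] b
          by (intro norm_sum_minus_suminf_le[where b = "\<lambda>k. b k * norm H"] summable_mult2)
        also have "\<dots> = (\<Sum>k. b (k + n)) * norm H"
          using b by (intro suminf_mult2[symmetric] summable_ignore_initial_segment)
        also have "\<dots> \<le> e * norm H"
          using N[OF \<open>n \<ge> N\<close>] by (intro mult_right_mono) auto
        finally show ?thesis .
      qed
      then show ?thesis
        unfolding eventually_sequentially by blast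
    qed
  qed
  then obtain g where g: "\<And>B. B \<in> S \<Longrightarrow> (\<lambda>k. (1 / fact k) *\<^sub>R matrix_pow B k) sums g B"
    and g': "(g has_derivative (\<lambda>H. \<Sum>k. f' k A H)) (at A within S)"
    using AS by blast
  \<comment> \<open>The limit function \<open>g\<close> is known only to exist; uniqueness of limits
    identifies it on the open set \<open>S\<close>, so its derivative at \<open>A\<close> carries
    over.\<close>
  have "g B = matrix_exp B" if "B \<in> S" for B
    using sums_unique2[OF g[OF that] matrix_exp_sums] .
  then show ?thesis
    using has_derivative_transform_within_open[OF _ \<open>open S\<close> AS] g'
    unfolding f'_def at_within_open[OF AS \<open>open S\<close>] by blast
qed

text \<open>\<open>frechet_derivative\<close> is a choice operator; uniqueness of derivatives
  identifies its value with the series.\<close>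

lemma L_exp_sums: "(\<lambda>k. (1 / fact k) *\<^sub>R matrix_pow_deriv k A H) sums L_exp A H"
  unfolding L_exp_def frechet_derivative_at[OF has_derivative_matrix_exp, symmetric]
  by (rule summable_sums[OF summable_matrix_pow_deriv])

section \<open>Bilinear forms and rank-one directions\<close>

lemma bilinear_form_outer_product: "x \<bullet> (outer_product u v *v y) = (x \<bullet> u) * (v \<bullet> y)"
proof -
  have "outer_product u v *v y = (v \<bullet> y) *\<^sub>R u"
    by (simp add: vec_eq_iff outer_product_def matrix_vector_mult_def inner_vec_def
        sum_distrib_left mult_ac)
  then show ?thesis by simp
qed

text \<open>Both sides factor as \<open>(x \<bullet> (P *v u)) * (v \<bullet> (Q *v y))\<close>;
  moving a matrix across the inner product transposes it.\<close>

lemma bilinear_form_sandwich_outer_product: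
  fixes P Q :: "real^'n^'n"
  shows "x \<bullet> ((P ** outer_product u v ** Q) *v y) =
    u \<bullet> ((transpose P ** outer_product x y ** transpose Q) *v v)"
proof -
  have "x \<bullet> ((P ** outer_product u v ** Q) *v y) = (x v* P) \<bullet> (outer_product u v *v (Q *v y))"
    by (simp add: dot_lmul_matrix flip: matrix_vector_mul_assoc)
  also have "\<dots> = (x \<bullet> (P *v u)) * (v \<bullet> (Q *v y))"
    by (simp only: bilinear_form_outer_product dot_lmul_matrix)
  also have "\<dots> = (u v* transpose P) \<bullet> (outer_product x y *v (transpose Q *v v))"
    by (simp add: bilinear_form_outer_product inner_commute[of _ x] inner_commute[of y]
        dot_lmul_matrix)
  also have "\<dots> = u \<bullet> ((transpose P ** outer_product x y ** transpose Q) *v v)"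
    by (simp only: dot_lmul_matrix matrix_vector_mul_assoc matrix_mul_assoc)
  finally show ?thesis .
qed

lemma bilinear_form_matrix_pow_deriv_outer_product:
  "x \<bullet> (matrix_pow_deriv k A (outer_product u v) *v y) =
    u \<bullet> (matrix_pow_deriv k (transpose A) (outer_product x y) *v v)"
  unfolding matrix_pow_deriv_def linear_sum[OF bounded_linear.linear[OF bounded_linear_bilinear_form]]
  by (simp add: bilinear_form_sandwich_outer_product[of x] transpose_matrix_pow)

theorem bilinear_form_L_exp_outer_product:
  "x \<bullet> (L_exp A (outer_product u v) *v y) = u \<bullet> (L_exp (transpose A) (outer_product x y) *v v)"
proof -
  \<comment> \<open>A bounded linear form may be applied termwise, so two series with equal terms
    remain to be compared.\<close>
  note sums = bounded_linear.sums[OF bounded_linear_bilinear_form L_exp_sums]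
  have "x \<bullet> (((1 / fact k) *\<^sub>R matrix_pow_deriv k A (outer_product u v)) *v y) =
      u \<bullet> (((1 / fact k) *\<^sub>R matrix_pow_deriv k (transpose A) (outer_product x y)) *v v)" for k
    by (simp add: bilinear_form_matrix_pow_deriv_outer_product[of x]
        flip: scaleR_matrix_vector_assoc)
  then have "(\<lambda>k. x \<bullet> (((1 / fact k) *\<^sub>R matrix_pow_deriv k A (outer_product u v)) *v y)) sums
      (u \<bullet> (L_exp (transpose A) (outer_product x y) *v v))"
    by (simp only: sums)
  with sums show ?thesis
    by (rule sums_unique2)
qed

theorem corollary2p4:
  fixes E :: "('n::finite \<times> 'n) set" and w :: "'n \<Rightarrow> 'n \<Rightarrow> real"
  assumes "weighted_digraph E w"
  shows "\<forall>i j. total_network_sensitivity (adjacency_matrix E w) i j =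
           L_exp (transpose (adjacency_matrix E w)) (outer_product 1 1) $ i $ j"
  unfolding total_network_sensitivity_def
  \<comment> \<open>Pairing with the unit vectors then reads off the entry at \<open>i\<close>,
    \<open>j\<close>.\<close>
  by (subst bilinear_form_L_exp_outer_product)
    (simp add: inner_axis' matrix_vector_mult_basis column_def)

end
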